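(* For every integer $s\ge1$, $$\Phi_s(y)=\frac{\tan\bigl((s+2)\arctan\sqrt y\bigr)}{\sqrt y},\qquad \Psi_s(y)=\frac1y\left(\frac{\cos^{s+2}(\arctan\sqrt y)}{\cos\bigl((s+2)\arctan\sqrt y\bigr)}-1\right).$$ Moreover, set $$\alpha_s:=\frac{\pi}{2(s+2)},\qquad y^*:=\tan^2\alpha_s,\qquad \kappa_s(y^* ):=\frac{2\sec^2\alpha_s}{(s+2)\,y^*},\qquad \lambda_s(y^* ):=\frac{2\cos^{s+3}\alpha_s}{(s+2)\sin^3\alpha_s}.$$ Then, as $m\to\infty$, $$N_{2m+1}(s)\sim\kappa_s(y^* )\,(y^* )^{-m},\qquad N_{2m+2}(s)\sim\lambda_s(y^* )\,(y^* )^{-m}.$$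
   Context: For integers $d\ge2$ and $s\ge1$ let $$\mathcal P_d^{(s)}=\{x=(x_1,\dots,x_d)\in\mathbb R_{\ge0}^d:\ x_i+x_{i+1}\le s+\delta_i,\ 1\le i\le d-1\},$$ where $\delta_i=0$ for $i$ odd and $\delta_i=1$ for $i$ even. Let $N_d(s):=\#(\mathcal P_d^{(s)}\cap\mathbb Z^d)$. Define $$\Phi_s(y):=(s+2)+\sum_{m\ge1}N_{2m+1}(s)\,y^m,\qquad \Psi_s(y):=\sum_{m\ge0}N_{2m+2}(s)\,y^m$$ (the constant term $s+2$ of $\Phi_s$ is an auxiliary normalization). The closed forms are identities of formal power series in $y$: the right-hand sides are even functions of $\sqrt y$ near $0$, so they expand as power series in $y$ (equivalently, the identities hold for all sufficiently small $y>0$). The notation $f(m)\sim g(m)$ means $f(m)/g(m)\to1$. *)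

theory Defs
  imports "HOL-Analysis.FPS_Convergence" "HOL-Library.Landau_Symbols" "HOL-Library.FuncSet"
begin

definition delta :: "nat \<Rightarrow> real" where
  "delta i = (if odd i then 0 else 1)"

text \<open>
  Since the dimension \<open>d\<close> varies, a point of \<open>d\<close>-space is a function on \<open>{1..d}\<close>, extended by
  \<open>undefined\<close> outside \<open>{1..d}\<close> so that distinct functions are distinct points.
\<close>

definition polytope_P :: "nat \<Rightarrow> nat \<Rightarrow> (nat \<Rightarrow> real) set" where
  "polytope_P d s =
     {x \<in> {1..d} \<rightarrow>\<^sub>E {0..}. \<forall>i\<in>{1..<d}. x i + x (i + 1) \<le> real s + delta i}"

definition lattice_Z :: "nat \<Rightarrow> (nat \<Rightarrow> real) set" where
  "lattice_Z d = {1..d} \<rightarrow>\<^sub>E \<int>"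

text \<open>Only \<open>d \<ge> 2\<close> is meaningful: for \<open>d = 1\<close> the set is an unbounded ray.\<close>

definition N :: "nat \<Rightarrow> nat \<Rightarrow> nat" where
  "N d s = card (polytope_P d s \<inter> lattice_Z d)"

definition Phi :: "nat \<Rightarrow> real fps" where
  "Phi s = Abs_fps (\<lambda>m. if m = 0 then real s + 2 else real (N (2 * m + 1) s))"

definition Psi :: "nat \<Rightarrow> real fps" where
  "Psi s = Abs_fps (\<lambda>m. real (N (2 * m + 2) s))"

text \<open>
  The right-hand sides of the closed forms are functions of \<open>sqrt y\<close> with a removable
  singularity at \<open>y = 0\<close>.  That a formal power series \<open>F\<close> in \<open>y\<close> equals such a function \<open>f\<close>
  is stated as: \<open>F\<close> has positive radius of convergence, and its sum is \<open>f y\<close> for all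
  sufficiently small \<open>y > 0\<close>.  This determines every coefficient of \<open>F\<close>.
\<close>

definition is_power_series_of :: "real fps \<Rightarrow> (real \<Rightarrow> real) \<Rightarrow> bool" where
  "is_power_series_of F f \<longleftrightarrow>
     fps_conv_radius F > 0 \<and> (\<forall>\<^sub>F y in at_right 0. eval_fps F y = f y)"

definition alpha :: "nat \<Rightarrow> real" where
  "alpha s = pi / (2 * (real s + 2))"

definition ystar :: "nat \<Rightarrow> real" where
  "ystar s = (tan (alpha s))\<^sup>2"

definition kappa :: "nat \<Rightarrow> real" where
  "kappa s = 2 * (1 / cos (alpha s))\<^sup>2 / ((real s + 2) * ystar s)"

definition lambda_const :: "nat \<Rightarrow> real" where
  "lambda_const s = 2 * cos (alpha s) ^ (s + 3) / ((real s + 2) * sin (alpha s) ^ 3)"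

end

theory Submission
  imports Defs
begin

text \<open>
  Fixing the last coordinate makes the lattice points computable one coordinate at a time: a point
  of \<open>polytope_P d s\<close> ending in \<open>j\<close> extends by \<open>k\<close> exactly when \<open>j + k \<le> s + delta d\<close>.  Let \<open>O\<^sub>k(y)\<close>
  be the generating function, over the odd dimensions \<open>2m+1\<close>, of the points ending in \<open>k\<close>; in
  dimension 1 each last coordinate \<open>0, \<dots>, s+1\<close> is counted once, which accounts for the constant
  term \<open>s + 2\<close> of \<open>Phi\<close>.  Let \<open>e\<^sub>k = O\<^sub>0 + \<dots> + O\<^sub>k\<^sub>-\<^sub>1\<close>; read backwards, these partial sums are the
  generating functions for even dimensions.  Taking differences of the two summation rules gives
  \<open>O\<^sub>k\<^sub>+\<^sub>1 = O\<^sub>k - y e\<^sub>k\<close> and \<open>e\<^sub>k\<^sub>+\<^sub>1 = e\<^sub>k + O\<^sub>k\<close>, that is, with \<open>y = t\<^sup>2\<close>,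
  \<open>O\<^sub>k + i t e\<^sub>k = O\<^sub>0 (1 + i t)\<^sup>k\<close>.

  The boundary values are \<open>O\<^sub>0 = 1 + y Psi\<close> at one end and, at \<open>k = s + 2\<close>, real part \<open>1\<close> and
  \<open>e = Phi\<close> at the other.  Since \<open>1 + i tan \<theta> = exp (i \<theta>) / cos \<theta>\<close>, putting \<open>t = tan \<theta>\<close> yields
  both closed forms.  The proof below stays over the reals: \<open>cos_poly n\<close> and \<open>sin_poly n\<close> are the
  polynomials in \<open>y\<close> with \<open>(1 + i t)\<^sup>n = cos_poly n + i t sin_poly n\<close>, so that
  \<open>Phi = sin_poly (s+2) / cos_poly (s+2)\<close> and \<open>1 + y Psi = 1 / cos_poly (s+2)\<close>
  (\<open>Phi_closed_form\<close>, \<open>Psi_closed_form\<close>).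

  For the asymptotics, \<open>cos_poly n\<close> vanishes at \<open>tan\<^sup>2\<close> of the odd multiples of \<open>pi / (2n)\<close> below
  \<open>pi / 2\<close>; they are as many as the degree allows, so the polynomial is the product of the factors
  \<open>1 - y / y\<^sub>k\<close> over these distinct positive roots (\<open>cos_poly_factorization\<close>).  Hence \<open>ystar s\<close> is
  the unique pole of smallest modulus and it is simple.  If \<open>G\<close> converges beyond \<open>r\<close>, the
  coefficient of \<open>y\<^sup>m\<close> in \<open>G(y) / (1 - y / r)\<close>, multiplied by \<open>r\<^sup>m\<close>, is a partial sum of \<open>G(r)\<close>
  (\<open>simple_pole_coeff_limit\<close>).  The limit involves the derivative of \<open>cos_poly (s+2)\<close> at
  \<open>ystar s\<close>, obtained by differentiating \<open>cos (n \<theta>) / cos\<^sup>n \<theta>\<close>, and it produces \<open>kappa\<close> and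
  \<open>lambda_const\<close>.
\<close>

section \<open>Lattice points sorted by their last coordinate\<close>

definition points_ending :: "nat \<Rightarrow> nat \<Rightarrow> nat \<Rightarrow> (nat \<Rightarrow> real) set" where
  "points_ending s d k = {x \<in> polytope_P d s \<inter> lattice_Z d. x d = real k}"

lemma Nats_eq_Ints_nonneg: "(x::real) \<in> \<nat> \<longleftrightarrow> x \<in> \<int> \<and> 0 \<le> x"
  by (auto simp: Nats_altdef2)

lemma real_s_delta: "real s + delta d = real (s + of_bool (even d))"
  by (simp add: delta_def)

lemma mem_points_ending_iff:
  "x \<in> points_ending s d k \<longleftrightarrow>
     (\<forall>i\<in>{1..d}. x i \<in> \<nat>) \<and> (\<forall>i. i \<notin> {1..d} \<longrightarrow> x i = undefined) \<and>
     (\<forall>i\<in>{1..<d}. x i + x (Suc i) \<le> real (s + of_bool (even i))) \<and> x d = real k"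
  unfolding points_ending_def polytope_P_def lattice_Z_def real_s_delta
  by (auto simp: PiE_iff extensional_def Nats_eq_Ints_nonneg)

lemma points_ending_adjacent:
  assumes "x \<in> points_ending s d k" "1 \<le> i" "i < d"
  shows "x i + x (Suc i) \<le> real (s + of_bool (even i))"
  using assms unfolding mem_points_ending_iff atLeastLessThan_iff Ball_def by blast

text \<open>
  The value at \<open>Suc d\<close> is overwritten because points are extended by \<open>undefined\<close>; together with
  the last coordinate \<open>j\<close> this makes the pieces of the union disjoint images of injective maps.
\<close>

lemma points_ending_Suc:
  assumes "d \<ge> 1"
  shows "points_ending s (Suc d) k =
    (\<Union>j\<in>{j. j + k \<le> s + of_bool (even d)}. (\<lambda>x. x(Suc d := real k)) ` points_ending s d j)"
    (is "?L = ?R")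
proof
  show "?L \<subseteq> ?R"
  proof
    fix x assume x: "x \<in> ?L"
    define x' where "x' = x(Suc d := undefined)"
    from x assms have "x d \<in> \<nat>" by (simp add: mem_points_ending_iff)
    then obtain j where j: "x d = real j" by (auto elim: Nats_cases)
    have "x' \<in> points_ending s d j"
      using x j by (auto simp: mem_points_ending_iff x'_def)
    moreover have "x = x'(Suc d := real k)"
      using x by (auto simp: mem_points_ending_iff x'_def)
    moreover have "j + k \<le> s + of_bool (even d)"
    proof -
      have "x d + x (Suc d) \<le> real (s + of_bool (even d))"
        using points_ending_adjacent[OF x, of d] assms by blast
      moreover have "x (Suc d) = real k"
        using x by (simp add: points_ending_def)
      ultimately have "real (j + k) \<le> real (s + of_bool (even d))" using j by simp
      then show ?thesis by (simp only: of_nat_le_iff)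
    qed
    ultimately show "x \<in> ?R" by auto
  qed
  show "?R \<subseteq> ?L"
  proof safe
    fix j x assume jk: "j + k \<le> s + of_bool (even d)" and x: "x \<in> points_ending s d j"
    have "real (j + k) \<le> real (s + of_bool (even d))" using jk by (simp only: of_nat_le_iff)
    then show "x(Suc d := real k) \<in> ?L"
      using x assms by (auto simp: mem_points_ending_iff less_Suc_eq split del: split_of_bool)
  qed
qed

lemma points_ending_1: "points_ending s 1 k = {\<lambda>i. if i = 1 then real k else undefined}"
  by (auto simp: mem_points_ending_iff fun_eq_iff)

lemma finite_lower_summands: "finite {j. j + k \<le> (M::nat)}"
  by (rule finite_subset[of _ "{..M}"]) auto

lemma finite_points_ending: "d \<ge> 1 \<Longrightarrow> finite (points_ending s d k)"
proof (induction d arbitrary: k rule: nat_induct_at_least)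
  case base
  show ?case by (subst points_ending_1) simp
next
  case (Suc d)
  then show ?case
    by (subst points_ending_Suc) (auto intro!: finite_lower_summands)
qed

lemma card_points_ending_Suc:
  assumes "d \<ge> 1"
  shows "card (points_ending s (Suc d) k) =
    (\<Sum>j | j + k \<le> s + of_bool (even d). card (points_ending s d j))"
proof -
  have inj: "inj_on (\<lambda>x. x(Suc d := real k)) (points_ending s d j)" for j
  proof (rule inj_onI)
    fix x y assume x: "x \<in> points_ending s d j" and y: "y \<in> points_ending s d j"
      and eq: "x(Suc d := real k) = y(Suc d := real k)"
    have "x i = y i" for i
    proof (cases "i = Suc d")
      case True
      then show ?thesis using x y by (auto simp: mem_points_ending_iff)
    next
      case False
      then show ?thesis using fun_cong[OF eq, of i] by simp
    qed
    then show "x = y" by blast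
  qed
  have dj: "x d = real j" if "x \<in> (\<lambda>x. x(Suc d := real k)) ` points_ending s d j" for x j
    using that by (auto simp: mem_points_ending_iff)
  have "card (points_ending s (Suc d) k) =
    (\<Sum>j | j + k \<le> s + of_bool (even d). card ((\<lambda>x. x(Suc d := real k)) ` points_ending s d j))"
    unfolding points_ending_Suc[OF assms]
  proof (rule card_UN_disjoint)
    show "\<forall>i\<in>{j. j + k \<le> s + of_bool (even d)}. \<forall>j\<in>{j. j + k \<le> s + of_bool (even d)}. i \<noteq> j \<longrightarrow>
      (\<lambda>x. x(Suc d := real k)) ` points_ending s d i \<inter>
      (\<lambda>x. x(Suc d := real k)) ` points_ending s d j = {}"
      using dj by (metis disjoint_iff of_nat_eq_iff)
  qed (use assms in \<open>simp_all add: finite_lower_summands finite_points_ending\<close>)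
  then show ?thesis by (simp add: card_image[OF inj])
qed

text \<open>
  From dimension 2 on, the last coordinate has a neighbour, and the constraint between them bounds
  it by \<open>s + 1\<close>.
\<close>

lemma N_eq_sum_points_ending:
  assumes "d \<ge> 2"
  shows "N d s = (\<Sum>k\<le>s + 1. card (points_ending s d k))"
proof -
  have "polytope_P d s \<inter> lattice_Z d = (\<Union>k\<in>{..s+1}. points_ending s d k)"
  proof (intro equalityI subsetI)
    fix x assume x: "x \<in> polytope_P d s \<inter> lattice_Z d"
    then have nat: "x i \<in> \<nat>" if "i \<in> {1..d}" for i
      using that by (auto simp: polytope_P_def lattice_Z_def Nats_eq_Ints_nonneg)
    obtain k where k: "x d = real k"
      using nat[of d] assms by (auto elim: Nats_cases)
    then have xk: "x \<in> points_ending s d k" using x by (simp add: points_ending_def)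
    obtain d' where d': "d = Suc d'" "d' \<ge> 1" using assms by (cases d) auto
    have "x d' \<ge> 0" using nat[of d'] d' by (auto simp: Nats_eq_Ints_nonneg)
    moreover have "x d' + x d \<le> real (s + of_bool (even d'))"
      using points_ending_adjacent[OF xk, of d'] d' by simp
    ultimately have "real k \<le> real (s + of_bool (even d'))" using k by linarith
    also have "\<dots> \<le> real (s + 1)" by simp
    finally have "k \<le> s + 1" by (simp only: of_nat_le_iff)
    then show "x \<in> (\<Union>k\<in>{..s+1}. points_ending s d k)" using xk by auto
  qed (auto simp: points_ending_def)
  moreover have "card (\<Union>k\<in>{..s+1}. points_ending s d k) = (\<Sum>k\<le>s+1. card (points_ending s d k))"
    by (rule card_UN_disjoint)
       (use assms in \<open>auto simp: finite_points_ending, auto simp: points_ending_def\<close>)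
  ultimately show ?thesis by (simp add: N_def)
qed

section \<open>A linear recurrence for the generating functions\<close>

text \<open>
  The constant term belongs to dimension 1, where \<open>points_ending s 1 k\<close> has one element for every
  \<open>k\<close>, even though the polytope itself is an unbounded ray.
\<close>

definition ending_gf :: "nat \<Rightarrow> nat \<Rightarrow> real fps" where
  "ending_gf s k = Abs_fps (\<lambda>m. real (card (points_ending s (2 * m + 1) k)))"

definition partial_gf :: "nat \<Rightarrow> nat \<Rightarrow> real fps" where
  "partial_gf s k = (\<Sum>j<k. ending_gf s j)"

text \<open>
  In even dimensions no generating function of its own is needed: the points ending in \<open>k\<close>
  extend points ending in some \<open>j < s + 1 - k\<close>, so the partial sums of \<open>ending_gf\<close> count them.
  Truncated subtraction makes the right-hand side 0 when \<open>k > s\<close>, as it should be.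
\<close>

lemma card_points_ending_even:
  "real (card (points_ending s (2 * m + 2) k)) = fps_nth (partial_gf s (s + 1 - k)) m"
proof -
  have "{j. j + k \<le> s} = {..<s + 1 - k}" by auto
  then show ?thesis
    using card_points_ending_Suc[of "2 * m + 1" s k]
    by (simp add: partial_gf_def ending_gf_def fps_sum_nth)
qed

lemma card_points_ending_odd:
  "real (card (points_ending s (2 * Suc m + 1) k)) =
     (\<Sum>j | j + k \<le> s + 1. fps_nth (partial_gf s (s + 1 - j)) m)"
  using card_points_ending_Suc[of "2 * m + 2" s k] card_points_ending_even[of s m]
  by simp

text \<open>
  Raising the last coordinate from \<open>k\<close> to \<open>k + 1\<close> excludes exactly one predecessor, namely
  \<open>s + 1 - k\<close>, and the reversal in \<open>card_points_ending_even\<close> turns its count into the partial sum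
  up to \<open>k\<close>.
\<close>

lemma ending_gf_Suc:
  assumes "k \<le> s"
  shows "ending_gf s (Suc k) = ending_gf s k - fps_X * partial_gf s k"
proof (rule fps_ext)
  fix m
  show "fps_nth (ending_gf s (Suc k)) m = fps_nth (ending_gf s k - fps_X * partial_gf s k) m"
  proof (cases m)
    case 0
    then show ?thesis using points_ending_1[of s] by (simp add: ending_gf_def)
  next
    case (Suc n)
    have "{j. j + k \<le> s + 1} = insert (s + 1 - k) {j. j + Suc k \<le> s + 1}"
      using assms by auto
    then have "(\<Sum>j | j + k \<le> s + 1. fps_nth (partial_gf s (s + 1 - j)) n) =
      fps_nth (partial_gf s k) n + (\<Sum>j | j + Suc k \<le> s + 1. fps_nth (partial_gf s (s + 1 - j)) n)"
      using assms finite_lower_summands[of "Suc k" "s + 1"] by (simp only:) (subst sum.insert, auto)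
    then show ?thesis
      using card_points_ending_odd[of s n k] card_points_ending_odd[of s n "Suc k"] Suc
      by (simp add: ending_gf_def)
  qed
qed

lemma partial_gf_Suc: "partial_gf s (Suc k) = partial_gf s k + ending_gf s k"
  by (simp add: partial_gf_def)

text \<open>
  The left-hand side continues the recurrence of \<open>ending_gf_Suc\<close> to index \<open>s + 2\<close>, where only the
  single point of dimension 1 remains, since \<open>s + 2\<close> exceeds every bound; this is the second
  boundary value.
\<close>

lemma ending_gf_last: "ending_gf s (s + 1) - fps_X * partial_gf s (s + 1) = 1"
proof (rule fps_ext)
  fix m
  have *: "{j. j + (s + 1) \<le> s + 1} = {0}" by auto
  show "fps_nth (ending_gf s (s + 1) - fps_X * partial_gf s (s + 1)) m = fps_nth 1 m"
  proof (cases m)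
    case 0
    then show ?thesis using points_ending_1[of s] by (simp add: ending_gf_def)
  next
    case (Suc n)
    have "fps_nth (ending_gf s (s + 1)) (Suc n) = fps_nth (partial_gf s (s + 1)) n"
      using card_points_ending_odd[of s n "s + 1", unfolded *] by (simp add: ending_gf_def)
    then show ?thesis using Suc by simp
  qed
qed

lemma Phi_eq_partial_gf: "Phi s = partial_gf s (s + 2)"
proof (rule fps_ext)
  fix m
  have *: "{..<s + 2} = {..s + 1}" by auto
  show "fps_nth (Phi s) m = fps_nth (partial_gf s (s + 2)) m"
    using points_ending_1[of s] N_eq_sum_points_ending[of "2 * m + 1" s]
    unfolding partial_gf_def * by (cases m) (simp_all add: Phi_def ending_gf_def fps_sum_nth)
qed

lemma Psi_eq_ending_gf: "1 + fps_X * Psi s = ending_gf s 0"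
proof (rule fps_ext)
  fix m
  show "fps_nth (1 + fps_X * Psi s) m = fps_nth (ending_gf s 0) m"
  proof (cases m)
    case 0
    then show ?thesis using points_ending_1[of s] by (simp add: ending_gf_def)
  next
    case (Suc n)
    have "{j. j + 0 \<le> s + 1} = {..s + 1}" by auto
    then show ?thesis
      using Suc N_eq_sum_points_ending[of "2 * n + 2" s] card_points_ending_Suc[of "2 * n + 2" s 0]
      by (simp add: ending_gf_def Psi_def)
  qed
qed

section \<open>Real and imaginary parts of powers of 1 + i t\<close>

text \<open>
  The recursion is multiplication by \<open>1 + i t\<close> with \<open>y = t\<^sup>2\<close>:
  \<open>(1 + i t)\<^sup>n = cos_poly n + i t sin_poly n\<close>.
\<close>

fun cos_poly :: "nat \<Rightarrow> real poly" and sin_poly :: "nat \<Rightarrow> real poly" where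
  "cos_poly 0 = 1"
| "cos_poly (Suc n) = cos_poly n - pCons 0 (sin_poly n)"
| "sin_poly 0 = 0"
| "sin_poly (Suc n) = sin_poly n + cos_poly n"

text \<open>
  De Moivre's formula for \<open>1 + i tan t = exp (i t) / cos t\<close>, read off by the addition theorems.
\<close>

lemma poly_cos_sin_poly:
  assumes "cos t \<noteq> 0"
  shows "poly (cos_poly n) ((tan t)\<^sup>2) = cos (real n * t) / cos t ^ n"
    and "tan t * poly (sin_poly n) ((tan t)\<^sup>2) = sin (real n * t) / cos t ^ n"
proof (induction n)
  case (Suc n)
  have arg: "real (Suc n) * t = real n * t + t" by (simp add: algebra_simps)
  {
    case 1
    have "poly (cos_poly (Suc n)) ((tan t)\<^sup>2) =
        cos (real n * t) / cos t ^ n - tan t * (tan t * poly (sin_poly n) ((tan t)\<^sup>2))"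
      using Suc.IH(1) by (simp add: power2_eq_square mult.assoc)
    also have "\<dots> = cos (real n * t) / cos t ^ n - tan t * (sin (real n * t) / cos t ^ n)"
      by (simp only: Suc.IH(2))
    also have "\<dots> = cos (real (Suc n) * t) / cos t ^ Suc n"
      unfolding arg cos_add using assms by (simp add: tan_def field_simps)
    finally show ?case .
  next
    case 2
    have "tan t * poly (sin_poly (Suc n)) ((tan t)\<^sup>2) =
        tan t * poly (sin_poly n) ((tan t)\<^sup>2) + tan t * poly (cos_poly n) ((tan t)\<^sup>2)"
      by (simp add: algebra_simps)
    also have "\<dots> = sin (real n * t) / cos t ^ n + tan t * (cos (real n * t) / cos t ^ n)"
      by (simp only: Suc.IH)
    also have "\<dots> = sin (real (Suc n) * t) / cos t ^ Suc n"
      unfolding arg sin_add using assms by (simp add: tan_def field_simps)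
    finally show ?case .
  }
qed auto

lemma degree_cos_sin_poly: "2 * degree (cos_poly n) \<le> n" "2 * degree (sin_poly n) \<le> n - 1"
proof (induction n)
  case (Suc n)
  {
    case 1
    have "2 * degree (pCons 0 (sin_poly n)) \<le> Suc n"
    proof (cases n)
      case (Suc m)
      then show ?thesis using Suc.IH(2) degree_pCons_le[of 0 "sin_poly n"] by linarith
    qed auto
    then show ?case using Suc.IH(1) degree_diff_le_max[of "cos_poly n" "pCons 0 (sin_poly n)"]
      by (simp add: max_def split: if_splits)
  next
    case 2
    then show ?case using Suc.IH degree_add_le_max[of "sin_poly n" "cos_poly n"]
      by (simp add: max_def split: if_splits)
  }
qed auto

lemma coeff_0_cos_poly: "coeff (cos_poly n) 0 = 1"
  by (induction n) (auto simp: coeff_pCons_0)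

section \<open>Closed forms\<close>

lemma fps_of_poly_cos_sin_poly_Suc:
  "fps_of_poly (cos_poly (Suc n)) = fps_of_poly (cos_poly n) - fps_X * fps_of_poly (sin_poly n)"
  "fps_of_poly (sin_poly (Suc n)) = fps_of_poly (sin_poly n) + fps_of_poly (cos_poly n)"
  by (simp_all add: fps_of_poly_add fps_of_poly_diff fps_of_poly_pCons mult.commute)

text \<open>
  The pair of generating functions obeys the recurrence that defines the pair of polynomials, with
  initial values \<open>ending_gf s 0\<close> and 0.
\<close>

lemma gf_eq_cos_sin_poly:
  "k \<le> s + 1 \<Longrightarrow> ending_gf s k = ending_gf s 0 * fps_of_poly (cos_poly k) \<and>
     partial_gf s k = ending_gf s 0 * fps_of_poly (sin_poly k)"
proof (induction k)
  case 0
  show ?case by (simp add: partial_gf_def)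
next
  case (Suc k)
  then show ?case
    by (simp add: ending_gf_Suc partial_gf_Suc fps_of_poly_cos_sin_poly_Suc algebra_simps
        del: cos_poly.simps sin_poly.simps)
qed

text \<open>
  The recurrence is started at an unknown value, and the boundary condition at the other end,
  \<open>ending_gf_last\<close>, determines it.
\<close>

lemma ending_gf_0: "ending_gf s 0 = inverse (fps_of_poly (cos_poly (s + 2)))"
proof -
  have n: "s + 2 = Suc (s + 1)" by simp
  have "fps_of_poly (cos_poly (s + 2)) * ending_gf s 0 =
      ending_gf s (s + 1) - fps_X * partial_gf s (s + 1)"
    unfolding n fps_of_poly_cos_sin_poly_Suc
    using gf_eq_cos_sin_poly[of "s + 1" s] by (simp only: algebra_simps order_refl)
  then have "fps_of_poly (cos_poly (s + 2)) * ending_gf s 0 = 1"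
    by (simp only: ending_gf_last)
  then show ?thesis by (simp add: fps_inverse_unique)
qed

theorem Phi_closed_form:
  "Phi s = fps_of_poly (sin_poly (s + 2)) * inverse (fps_of_poly (cos_poly (s + 2)))"
proof -
  have n: "s + 2 = Suc (s + 1)" by simp
  have "partial_gf s (s + 2) = fps_of_poly (sin_poly (s + 2)) * ending_gf s 0"
    unfolding n fps_of_poly_cos_sin_poly_Suc partial_gf_Suc
    using gf_eq_cos_sin_poly[of "s + 1" s] by (simp only: algebra_simps order_refl)
  then show ?thesis by (simp only: Phi_eq_partial_gf ending_gf_0)
qed

theorem Psi_closed_form: "1 + fps_X * Psi s = inverse (fps_of_poly (cos_poly (s + 2)))"
  by (simp only: Psi_eq_ending_gf ending_gf_0)

lemma eval_fps_inverse_poly: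
  fixes p :: "real poly"
  assumes "coeff p 0 \<noteq> 0" "ereal (norm y) < fps_conv_radius (inverse (fps_of_poly p))"
  shows "poly p y \<noteq> 0" "eval_fps (inverse (fps_of_poly p)) y = 1 / poly p y"
proof -
  have "eval_fps (inverse (fps_of_poly p) * fps_of_poly p) y =
      eval_fps (inverse (fps_of_poly p)) y * poly p y"
    using assms by (subst eval_fps_mult) auto
  moreover have "inverse (fps_of_poly p) * fps_of_poly p = 1"
    using assms by (intro inverse_mult_eq_1) auto
  ultimately have "eval_fps (inverse (fps_of_poly p)) y * poly p y = 1" by simp
  then show "poly p y \<noteq> 0" "eval_fps (inverse (fps_of_poly p)) y = 1 / poly p y"
    by (auto simp: eq_divide_eq)
qed

lemma is_power_series_ofI:
  assumes "R > 0" "R \<le> fps_conv_radius F" "\<And>y. y > 0 \<Longrightarrow> ereal y < R \<Longrightarrow> eval_fps F y = f y"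
  shows "is_power_series_of F f"
proof -
  have "0 < fps_conv_radius F" using assms by (meson less_le_trans)
  moreover have "\<forall>\<^sub>F y in at_right 0. eval_fps F y = f y"
  proof -
    obtain q where q: "0 < ereal q" "ereal q < R" using ereal_dense2[of 0 R] assms by auto
    then have "\<forall>\<^sub>F y in at_right 0. y \<in> {0<..<q}"
      by (intro eventually_at_right_real) simp
    then show ?thesis
    proof eventually_elim
      case (elim y)
      then show ?case using q assms(3)[of y] by (metis ereal_less(3) greaterThanLessThan_iff less_ereal.simps(1) less_trans)
    qed
  qed
  ultimately show ?thesis by (simp add: is_power_series_of_def)
qed

lemma closed_form_expansions:
  "is_power_series_of (Phi s) (\<lambda>y. tan ((real s + 2) * arctan (sqrt y)) / sqrt y)"
  "is_power_series_of (Psi s) (\<lambda>y. (1 / y) * (cos (arctan (sqrt y)) ^ (s + 2)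
                            / cos ((real s + 2) * arctan (sqrt y)) - 1))"
proof -
  define C where "C = fps_of_poly (cos_poly (s + 2))"
  define R where "R = fps_conv_radius (inverse C)"
  have R: "R > 0"
    unfolding R_def C_def by (rule fps_conv_radius_inverse_pos) (simp_all add: coeff_0_cos_poly)
  have n: "real (s + 2) = real s + 2" by simp
  have evals:
    "eval_fps (inverse C) y =
       cos (arctan (sqrt y)) ^ (s + 2) / cos ((real s + 2) * arctan (sqrt y))"
    "sqrt y * poly (sin_poly (s + 2)) y =
       sin ((real s + 2) * arctan (sqrt y)) / cos (arctan (sqrt y)) ^ (s + 2)"
    "cos (arctan (sqrt y)) \<noteq> 0"
    if y: "y > 0" "ereal y < R" for y
  proof -
    show c: "cos (arctan (sqrt y)) \<noteq> 0" by (rule cos_arctan_not_zero)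
    have tan: "tan (arctan (sqrt y)) = sqrt y" "(sqrt y)\<^sup>2 = y" using y by (simp_all add: tan_arctan)
    have "eval_fps (inverse C) y = 1 / poly (cos_poly (s + 2)) y"
      unfolding C_def
      by (rule eval_fps_inverse_poly) (use y in \<open>simp_all add: coeff_0_cos_poly R_def C_def\<close>)
    then show "eval_fps (inverse C) y =
       cos (arctan (sqrt y)) ^ (s + 2) / cos ((real s + 2) * arctan (sqrt y))"
      using poly_cos_sin_poly(1)[OF c, of "s + 2", unfolded tan n] by simp
    show "sqrt y * poly (sin_poly (s + 2)) y =
       sin ((real s + 2) * arctan (sqrt y)) / cos (arctan (sqrt y)) ^ (s + 2)"
      using poly_cos_sin_poly(2)[OF c, of "s + 2", unfolded tan n] .
  qed
  show "is_power_series_of (Phi s) (\<lambda>y. tan ((real s + 2) * arctan (sqrt y)) / sqrt y)"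
  proof (rule is_power_series_ofI[OF R])
    show "R \<le> fps_conv_radius (Phi s)"
      unfolding Phi_closed_form R_def C_def
      by (rule order.trans[OF _ fps_conv_radius_mult]) simp
    fix y :: real assume y: "y > 0" "ereal y < R"
    have "eval_fps (Phi s) y = poly (sin_poly (s + 2)) y * eval_fps (inverse C) y"
      unfolding Phi_closed_form C_def[symmetric]
      by (subst eval_fps_mult) (use y in \<open>simp_all add: R_def C_def\<close>)
    then have "sqrt y * eval_fps (Phi s) y = tan ((real s + 2) * arctan (sqrt y))"
      using evals[OF y] by (simp add: tan_def field_simps)
    then show "eval_fps (Phi s) y = tan ((real s + 2) * arctan (sqrt y)) / sqrt y"
      using y by (simp add: field_simps)
  qed
  show "is_power_series_of (Psi s) (\<lambda>y. (1 / y) * (cos (arctan (sqrt y)) ^ (s + 2)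
                            / cos ((real s + 2) * arctan (sqrt y)) - 1))"
  proof (rule is_power_series_ofI[OF R])
    have "Psi s = fps_shift 1 (1 + fps_X * Psi s)"
      by (rule fps_ext) simp
    also have "\<dots> = fps_shift 1 (inverse C)" by (simp only: Psi_closed_form C_def)
    finally have rad: "fps_conv_radius (Psi s) = R"
      using fps_conv_radius_shift[of 1 "inverse C"] by (simp add: R_def)
    then show "R \<le> fps_conv_radius (Psi s)" by simp
    fix y :: real assume y: "y > 0" "ereal y < R"
    have "eval_fps (inverse C) y = eval_fps (1 + fps_X * Psi s) y"
      by (simp only: Psi_closed_form C_def)
    also have "\<dots> = 1 + eval_fps (fps_X * Psi s) y"
      by (subst eval_fps_add)
         (use y rad less_le_trans[OF _ fps_conv_radius_mult[of fps_X "Psi s"]] in simp_all)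
    also have "eval_fps (fps_X * Psi s) y = y * eval_fps (Psi s) y"
      by (subst eval_fps_mult) (use y rad in simp_all)
    finally show "eval_fps (Psi s) y = (1 / y) * (cos (arctan (sqrt y)) ^ (s + 2)
                            / cos ((real s + 2) * arctan (sqrt y)) - 1)"
      using evals(1)[OF y] y by (simp add: field_simps)
  qed
qed

section \<open>Factorization of the denominator\<close>

text \<open>
  The odd multiples of \<open>pi / (2 n)\<close>; those below \<open>pi / 2\<close> have index \<open>k < n div 2\<close>.
\<close>

definition root_angle :: "nat \<Rightarrow> nat \<Rightarrow> real" where
  "root_angle n k = (2 * real k + 1) * (pi / (2 * real n))"

lemma root_angle_bounds:
  assumes "k < n div 2"
  shows "0 < root_angle n k" "root_angle n k < pi / 2"
proof -
  have n: "n > 0" using assms by (cases n) auto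
  show "0 < root_angle n k" using n by (simp add: root_angle_def)
  have "2 * k + 1 < n" using assms by linarith
  then have "2 * real k + 1 < real n" by linarith
  then have "(2 * real k + 1) * (pi / (2 * real n)) < real n * (pi / (2 * real n))"
    using n by (intro mult_strict_right_mono) auto
  then show "root_angle n k < pi / 2" using n by (simp add: root_angle_def)
qed

lemma root_angle_strict_mono: "j < k \<Longrightarrow> n > 0 \<Longrightarrow> root_angle n j < root_angle n k"
  unfolding root_angle_def by (intro mult_strict_right_mono) auto

lemma tan_sq_strict_mono:
  assumes "0 \<le> t" "t < u" "u < pi / 2"
  shows "(tan t)\<^sup>2 < (tan u)\<^sup>2"
proof (rule power_strict_mono)
  show "tan t < tan u" using assms pi_gt_zero by (intro tan_monotone) linarith+
  show "0 \<le> tan t"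
    using assms tan_gt_zero[of t] by (cases "t = 0") auto
qed simp

definition cos_root :: "nat \<Rightarrow> nat \<Rightarrow> real" where
  "cos_root n k = (tan (root_angle n k))\<^sup>2"

lemma cos_root_less: "j < k \<Longrightarrow> k < n div 2 \<Longrightarrow> cos_root n j < cos_root n k"
  unfolding cos_root_def
  by (rule tan_sq_strict_mono)
     (use root_angle_bounds[of j n] root_angle_bounds[of k n] root_angle_strict_mono[of j k n] in auto)

lemma cos_root_pos: "k < n div 2 \<Longrightarrow> 0 < cos_root n k"
  unfolding cos_root_def using root_angle_bounds[of k n] tan_gt_zero[of "root_angle n k"] by simp

lemma poly_cos_poly_root:
  assumes "k < n div 2"
  shows "poly (cos_poly n) (cos_root n k) = 0"
proof -
  have n: "n > 0" using assms by (cases n) auto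
  have "cos (root_angle n k) > 0"
    using root_angle_bounds[OF assms] by (intro cos_gt_zero) auto
  moreover have "cos (real n * root_angle n k) = 0"
  proof -
    have "real n * root_angle n k = real k * pi + pi / 2"
      using n by (simp add: root_angle_def field_simps)
    then show ?thesis by (simp add: cos_add)
  qed
  ultimately show ?thesis by (simp add: cos_root_def poly_cos_sin_poly)
qed

text \<open>
  Both sides have degree at most \<open>n div 2\<close> and agree at the \<open>n div 2\<close> roots and at 0, where both
  are 1; that is one point more than the degree.
\<close>

lemma cos_poly_factorization: "cos_poly n = (\<Prod>k<n div 2. [:1, - 1 / cos_root n k:])"
proof (rule poly_eqI_degree[where A = "insert 0 (cos_root n ` {..<n div 2})"])
  have "inj_on (cos_root n) {..<n div 2}"
    by (rule inj_onI) (metis cos_root_less lessThan_iff less_irrefl linorder_neqE_nat)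
  moreover have "0 \<notin> cos_root n ` {..<n div 2}" using cos_root_pos by force
  ultimately have card: "card (insert 0 (cos_root n ` {..<n div 2})) = Suc (n div 2)"
    by (simp add: card_image)
  have "degree (cos_poly n) \<le> n div 2" using degree_cos_sin_poly(1)[of n] by linarith
  then show "degree (cos_poly n) < card (insert 0 (cos_root n ` {..<n div 2}))"
    unfolding card by simp
  have "degree (\<Prod>k<n div 2. [:1, - 1 / cos_root n k:]) \<le> 
      (\<Sum>k<n div 2. degree [:1, - 1 / cos_root n k:])"
    by (rule degree_prod_sum_le[unfolded o_def]) simp
  also have "\<dots> \<le> (\<Sum>k<n div 2. 1)" by (intro sum_mono) simp
  finally show "degree (\<Prod>k<n div 2. [:1, - 1 / cos_root n k:]) <
      card (insert 0 (cos_root n ` {..<n div 2}))"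
    unfolding card by simp
next
  fix y assume "y \<in> insert 0 (cos_root n ` {..<n div 2})"
  then consider "y = 0" | k where "k < n div 2" "y = cos_root n k" by auto
  then show "poly (cos_poly n) y = poly (\<Prod>k<n div 2. [:1, - 1 / cos_root n k:]) y"
  proof cases
    case 1
    then show ?thesis
      using coeff_0_cos_poly[of n] by (simp add: poly_prod flip: poly_0_coeff_0)
  next
    case 2
    have "(\<Prod>j<n div 2. poly [:1, - 1 / cos_root n j:] y) = 0"
      using 2 cos_root_pos[of k n] by (intro prod_zero) (auto intro!: bexI[of _ k])
    then show ?thesis using 2 poly_cos_poly_root[of k n] by (simp add: poly_prod)
  qed
qed

section \<open>Coefficients near a dominant simple pole\<close>

lemma inverse_linear_fps: "inverse (fps_of_poly [:1, - c:]) = Abs_fps (\<lambda>n. (c::real) ^ n)"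
proof (rule fps_inverse_unique)
  show "fps_of_poly [:1, - c:] * Abs_fps (\<lambda>n. c ^ n) = 1"
  proof (rule fps_ext)
    fix m
    show "fps_nth (fps_of_poly [:1, - c:] * Abs_fps (\<lambda>n. c ^ n)) m = fps_nth 1 m"
      unfolding fps_of_poly_linear'
      by (cases m) (simp_all add: left_diff_distrib mult.assoc flip: fps_const_neg)
  qed
qed

lemma conv_radius_inverse_linear:
  assumes "r > 0"
  shows "fps_conv_radius (inverse (fps_of_poly [:1, - 1 / r:])) \<ge> ereal r"
proof -
  have "conv_radius (\<lambda>n. (1 / r) ^ n) \<ge> ereal r"
  proof (rule conv_radius_geI_ex')
    fix q :: real assume "0 < q" "ereal q < ereal r"
    then have "summable (\<lambda>n. (q / r) ^ n)" by (intro summable_geometric) auto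
    then show "summable (\<lambda>n. (1 / r) ^ n * of_real q ^ n)"
      by (simp add: power_divide)
  qed
  then show ?thesis using inverse_linear_fps[of "1 / r"] by (simp add: fps_conv_radius_def)
qed

text \<open>
  Used for the denominator deprived of its smallest root, this shows that the rest of the
  generating function is still analytic beyond that root.
\<close>

lemma conv_radius_inverse_prod_linear:
  assumes "finite K" "\<And>k. k \<in> K \<Longrightarrow> R \<le> r k" "R > 0"
  shows "fps_conv_radius (inverse (fps_of_poly (\<Prod>k\<in>K. [:1, - 1 / r k:]))) \<ge> ereal R"
  using assms
proof (induction K rule: finite_induct)
  case (insert k K)
  have "ereal R \<le> ereal (r k)" using insert by simp
  also have "\<dots> \<le> fps_conv_radius (inverse (fps_of_poly [:1, - 1 / r k:]))"
    using insert by (intro conv_radius_inverse_linear) (meson insertI1 less_le_trans)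
  finally have 1: "ereal R \<le> fps_conv_radius (inverse (fps_of_poly [:1, - 1 / r k:]))" .
  have 2: "ereal R \<le> fps_conv_radius (inverse (fps_of_poly (\<Prod>k\<in>K. [:1, - 1 / r k:])))"
    using insert by simp
  show ?case
    unfolding prod.insert[OF insert.hyps] fps_of_poly_mult fps_inverse_mult
    by (rule order.trans[OF _ fps_conv_radius_mult]) (use 1 2 in simp)
qed simp

text \<open>
  Dividing by \<open>1 - x / r\<close> convolves the coefficients with \<open>(1 / r)\<^sup>m\<close>, so after scaling by \<open>r\<^sup>m\<close>
  they are the partial sums of the series for \<open>G(r)\<close>.
\<close>

lemma simple_pole_coeff_limit:
  fixes G :: "real fps"
  assumes "r > 0" "ereal r < fps_conv_radius G"
  shows "(\<lambda>m. fps_nth (G * inverse (fps_of_poly [:1, - 1 / r:])) m * r ^ m) \<longlonglongrightarrow> eval_fps G r"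
proof -
  have eq: "fps_nth (G * inverse (fps_of_poly [:1, - 1 / r:])) m * r ^ m =
      (\<Sum>i<Suc m. fps_nth G i * r ^ i)" for m
  proof -
    have "fps_nth (G * inverse (fps_of_poly [:1, - 1 / r:])) m * r ^ m =
        (\<Sum>i=0..m. fps_nth G i * (1 / r) ^ (m - i) * r ^ m)"
      using inverse_linear_fps[of "1 / r"] by (simp add: fps_mult_nth sum_distrib_right)
    also have "\<dots> = (\<Sum>i=0..m. fps_nth G i * r ^ i)"
      using assms by (intro sum.cong) (auto simp: field_simps power_diff)
    finally show ?thesis by (simp only: lessThan_Suc_atMost atLeast0AtMost)
  qed
  have "(\<lambda>i. fps_nth G i * r ^ i) sums eval_fps G r"
    using assms by (intro sums_eval_fps) simp
  then show ?thesis unfolding eq sums_def by (rule LIMSEQ_Suc)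
qed

section \<open>Asymptotics of the counts\<close>

lemma alpha_bounds: "0 < alpha s" "alpha s < pi / 2"
  using root_angle_bounds[of 0 "s + 2"] by (simp_all add: alpha_def root_angle_def add.commute)

lemma ystar_eq_cos_root: "ystar s = cos_root (s + 2) 0"
  by (simp add: ystar_def cos_root_def root_angle_def alpha_def add.commute)

lemma cos_sin_alpha_pos: "cos (alpha s) > 0" "sin (alpha s) > 0"
  using alpha_bounds[of s] pi_gt_zero by (auto intro!: cos_gt_zero sin_gt_zero simp del: pi_gt_zero)

lemma sin_cos_multiple_alpha: "sin ((real s + 2) * alpha s) = 1" "cos ((real s + 2) * alpha s) = 0"
proof -
  have "(real s + 2) * alpha s = pi / 2" by (simp add: alpha_def field_simps)
  then show "sin ((real s + 2) * alpha s) = 1" "cos ((real s + 2) * alpha s) = 0"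
    by (simp_all only: sin_pi_half cos_pi_half)
qed

text \<open>
  Differentiate \<open>cos (n t) / cos\<^sup>n t\<close> at \<open>alpha s\<close>, where \<open>n = s + 2\<close>: only the derivative of the
  numerator survives, because \<open>cos (n alpha) = 0\<close>, and \<open>sin (n alpha) = 1\<close>.
\<close>

lemma deriv_cos_poly_ystar:
  "poly (pderiv (cos_poly (s + 2))) (ystar s) * (2 * tan (alpha s)) = - (real s + 2) / cos (alpha s) ^ s"
proof -
  define a n p where "a = alpha s" and "n = real s + 2" and "p = cos_poly (s + 2)"
  have c: "cos a \<noteq> 0" "cos a ^ (s + 2) \<noteq> 0" using cos_sin_alpha_pos[of s] by (simp_all add: a_def)
  have na: "sin (n * a) = 1" "cos (n * a) = 0"
    using sin_cos_multiple_alpha[of s] by (simp_all only: a_def n_def)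
  have "((\<lambda>t. (tan t)\<^sup>2) has_real_derivative 2 * tan a * inverse ((cos a)\<^sup>2)) (at a)"
    using c by (auto intro!: derivative_eq_intros)
  then have lhs: "((\<lambda>t. poly p ((tan t)\<^sup>2)) has_real_derivative
      poly (pderiv p) ((tan a)\<^sup>2) * (2 * tan a * inverse ((cos a)\<^sup>2))) (at a)"
    by (rule DERIV_chain2[OF poly_DERIV])
  have num: "((\<lambda>t. cos (n * t)) has_real_derivative - n) (at a)"
    using na by (auto intro!: derivative_eq_intros)
  have den: "((\<lambda>t. cos t ^ (s + 2)) has_real_derivative
      real (s + 2) * (cos a ^ (s + 1) * - sin a)) (at a)"
    by (rule derivative_eq_intros refl)+ simp
  have quot: "((\<lambda>t. cos (n * t) / cos t ^ (s + 2)) has_real_derivative - n / cos a ^ (s + 2)) (at a)"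
    using DERIV_divide[OF num den c(2)] c(2) unfolding na(2) by (simp del: power_add power_Suc)
  have ev: "\<forall>\<^sub>F t in nhds a. cos (n * t) / cos t ^ (s + 2) = poly p ((tan t)\<^sup>2)"
  proof -
    have "\<forall>\<^sub>F t in nhds a. t \<in> {0<..<pi/2}"
      using alpha_bounds[of s] by (intro eventually_nhds_in_open) (auto simp: a_def)
    then show ?thesis
    proof eventually_elim
      case (elim t)
      then have "cos t \<noteq> 0" using cos_gt_zero[of t] by auto
      note poly_cos_sin_poly(1)[OF this, of "s + 2", symmetric]
      moreover have "n = real (s + 2)" by (simp add: n_def)
      ultimately show ?case by (simp only: p_def)
    qed
  qed
  from DERIV_unique[OF lhs DERIV_cong_ev[OF refl ev refl, THEN iffD1, OF quot]]
  have "poly (pderiv p) ((tan a)\<^sup>2) * (2 * tan a) = - n / cos a ^ (s + 2) * (cos a)\<^sup>2"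
    using c(1) by (simp add: field_simps)
  also have "\<dots> = - n / cos a ^ s"
    using c(1) by (simp add: power_add power2_eq_square)
  finally show ?thesis by (simp only: a_def n_def p_def ystar_def)
qed

text \<open>
  At a simple zero the cofactor is, up to the factor \<open>- ystar s\<close>, the derivative of the product.
\<close>

lemma cofactor_at_ystar:
  assumes "cos_poly (s + 2) = [:1, - 1 / ystar s:] * D"
  shows "poly D (ystar s) = (real s + 2) * tan (alpha s) / (2 * cos (alpha s) ^ s)"
proof -
  have y: "ystar s > 0" unfolding ystar_eq_cos_root by (rule cos_root_pos) simp
  have t: "tan (alpha s) > 0" using cos_sin_alpha_pos[of s] by (simp add: tan_def)
  then have t2: "2 * tan (alpha s) \<noteq> 0" by simp
  have "poly (pderiv (cos_poly (s + 2))) (ystar s) = - poly D (ystar s) / ystar s"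
    unfolding assms pderiv_mult using y by (simp add: pderiv_pCons)
  then have "- poly D (ystar s) / ystar s * (2 * tan (alpha s)) = - (real s + 2) / cos (alpha s) ^ s"
    using deriv_cos_poly_ystar[of s] by (simp only:)
  then have "poly D (ystar s) / ystar s * (2 * tan (alpha s)) = (real s + 2) / cos (alpha s) ^ s"
    by (simp only: minus_divide_left[symmetric] mult_minus_left neg_equal_iff_equal)
  then have "poly D (ystar s) * (2 * tan (alpha s)) = ystar s * ((real s + 2) / cos (alpha s) ^ s)"
    using y by (simp add: field_simps)
  then have "poly D (ystar s) = ystar s * ((real s + 2) / cos (alpha s) ^ s) / (2 * tan (alpha s))"
    by (simp only: nonzero_eq_divide_eq[OF t2])
  also have "\<dots> = (real s + 2) * tan (alpha s) / (2 * cos (alpha s) ^ s)"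
    using t by (simp add: ystar_def power2_eq_square mult.commute)
  finally show ?thesis .
qed

text \<open>
  Both generating functions have this form: the numerator is \<open>sin_poly (s + 2)\<close> for \<open>Phi\<close> and 1
  for \<open>1 + y Psi\<close>.
\<close>

lemma coeff_limit_over_cos_poly:
  fixes P :: "real poly"
  shows "(\<lambda>m. fps_nth (fps_of_poly P * inverse (fps_of_poly (cos_poly (s + 2)))) m * ystar s ^ m)
     \<longlonglongrightarrow> 2 * poly P (ystar s) * cos (alpha s) ^ s / ((real s + 2) * tan (alpha s))"
proof -
  let ?n = "s + 2" and ?K = "{..<(s + 2) div 2}"
  define D where "D = (\<Prod>k\<in>?K - {0}. [:1, - 1 / cos_root ?n k:])"
  have fact: "cos_poly ?n = [:1, - 1 / ystar s:] * D"
    unfolding cos_poly_factorization ystar_eq_cos_root D_def by (rule prod.remove) auto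
  have y: "ystar s > 0" unfolding ystar_eq_cos_root by (rule cos_root_pos) simp
  have D0: "coeff D 0 = 1" by (simp add: D_def poly_prod flip: poly_0_coeff_0)
  \<comment> \<open>The second smallest root serves as \<open>R\<close>; when \<open>s < 2\<close> there is none and any larger number does.\<close>
  have "\<exists>R > ystar s. \<forall>k\<in>?K - {0}. R \<le> cos_root ?n k"
  proof (cases "1 < ?n div 2")
    case True
    have "cos_root ?n 1 \<le> cos_root ?n k" if "k \<in> ?K - {0}" for k
      using that cos_root_less[of 1 k ?n] by (cases "k = 1") auto
    moreover have "cos_root ?n 1 > ystar s"
      using cos_root_less[OF _ True, of 0] by (simp only: ystar_eq_cos_root zero_less_one)
    ultimately show ?thesis by blast
  next
    case False
    then have "?K - {0} = {}" by auto
    then show ?thesis by (metis empty_iff gt_ex)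
  qed
  then obtain R where R: "R > ystar s" "\<And>k. k \<in> ?K - {0} \<Longrightarrow> R \<le> cos_root ?n k" by blast
  have "ereal (ystar s) < ereal R" using R by simp
  also have "ereal R \<le> fps_conv_radius (inverse (fps_of_poly D))"
    unfolding D_def by (rule conv_radius_inverse_prod_linear) (use R y in auto)
  finally have rad: "ereal (ystar s) < fps_conv_radius (inverse (fps_of_poly D))" .
  also have "\<dots> \<le> fps_conv_radius (fps_of_poly P * inverse (fps_of_poly D))"
    by (rule order.trans[OF _ fps_conv_radius_mult]) simp
  finally have lim: "(\<lambda>m. fps_nth (fps_of_poly P * inverse (fps_of_poly D) *
      inverse (fps_of_poly [:1, - 1 / ystar s:])) m * ystar s ^ m)
      \<longlonglongrightarrow> eval_fps (fps_of_poly P * inverse (fps_of_poly D)) (ystar s)"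
    by (intro simple_pole_coeff_limit y)
  have split: "fps_of_poly P * inverse (fps_of_poly D) * inverse (fps_of_poly [:1, - 1 / ystar s:]) =
      fps_of_poly P * inverse (fps_of_poly (cos_poly ?n))"
    unfolding fact fps_of_poly_mult fps_inverse_mult by (simp add: mult_ac)
  have "eval_fps (fps_of_poly P * inverse (fps_of_poly D)) (ystar s) =
      poly P (ystar s) / poly D (ystar s)"
    using rad y D0 eval_fps_inverse_poly(2)[of D "ystar s"] by (subst eval_fps_mult) auto
  also have "\<dots> = 2 * poly P (ystar s) * cos (alpha s) ^ s / ((real s + 2) * tan (alpha s))"
    by (simp add: cofactor_at_ystar[OF fact] mult_ac)
  finally show ?thesis using lim by (simp only: split)
qed

lemma asymp_equiv_powi_of_limit:
  fixes f :: "nat \<Rightarrow> real"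
  assumes lim: "(\<lambda>m. f m * r ^ m) \<longlonglongrightarrow> c" and "c \<noteq> 0" "r > 0"
  shows "f \<sim>[sequentially] (\<lambda>m. c * r powi (- int m))"
proof (rule asymp_equivI')
  have "(\<lambda>m. f m * r ^ m / c) \<longlonglongrightarrow> c / c"
    using assms by (intro tendsto_divide tendsto_const) auto
  then show "(\<lambda>m. f m / (c * r powi (- int m))) \<longlonglongrightarrow> 1"
    using assms by (simp add: power_int_minus field_simps)
qed

lemma N_odd_asymptotics:
  "(\<lambda>m. real (N (2 * m + 1) s)) \<sim>[sequentially] (\<lambda>m. kappa s * ystar s powi (- int m))"
proof -
  have y: "ystar s > 0" unfolding ystar_eq_cos_root by (rule cos_root_pos) simp
  have c: "cos (alpha s) > 0" and si: "sin (alpha s) > 0" by (rule cos_sin_alpha_pos)+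
  have t: "tan (alpha s) > 0" using c si by (simp add: tan_def)
  have "tan (alpha s) * poly (sin_poly (s + 2)) (ystar s) = 1 / cos (alpha s) ^ (s + 2)"
    using poly_cos_sin_poly(2)[of "alpha s" "s + 2"] sin_cos_multiple_alpha[of s] c
    by (simp add: ystar_def add.commute)
  then have P: "poly (sin_poly (s + 2)) (ystar s) = 1 / (tan (alpha s) * cos (alpha s) ^ (s + 2))"
    using t c by (simp add: field_simps)
  have "2 * poly (sin_poly (s + 2)) (ystar s) * cos (alpha s) ^ s / ((real s + 2) * tan (alpha s)) = kappa s"
    unfolding P kappa_def using t c by (simp add: ystar_def field_simps power_add power2_eq_square)
  then have lim: "(\<lambda>m. fps_nth (Phi s) m * ystar s ^ m) \<longlonglongrightarrow> kappa s"
    using coeff_limit_over_cos_poly[of "sin_poly (s + 2)" s] by (simp only: Phi_closed_form)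
  have "\<forall>\<^sub>F m in sequentially. fps_nth (Phi s) m * ystar s ^ m = real (N (2 * m + 1) s) * ystar s ^ m"
    using eventually_gt_at_top[of 0] by eventually_elim (simp add: Phi_def)
  with lim have "(\<lambda>m. real (N (2 * m + 1) s) * ystar s ^ m) \<longlonglongrightarrow> kappa s"
    by (rule Lim_transform_eventually)
  moreover have "kappa s \<noteq> 0" using y c by (simp add: kappa_def add_nonneg_eq_0_iff)
  ultimately show ?thesis using y by (rule asymp_equiv_powi_of_limit)
qed

text \<open>
  The count in dimension \<open>2m + 2\<close> is the coefficient of \<open>y\<close> to the power \<open>m + 1\<close> in \<open>1 + y Psi\<close>;
  the index shift accounts for an extra division by \<open>ystar s\<close>.
\<close>

lemma N_even_asymptotics:
  "(\<lambda>m. real (N (2 * m + 2) s)) \<sim>[sequentially] (\<lambda>m. lambda_const s * ystar s powi (- int m))"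
proof -
  have y: "ystar s > 0" unfolding ystar_eq_cos_root by (rule cos_root_pos) simp
  have c: "cos (alpha s) > 0" and si: "sin (alpha s) > 0" by (rule cos_sin_alpha_pos)+
  let ?c = "2 * cos (alpha s) ^ s / ((real s + 2) * tan (alpha s))"
  have "(\<lambda>m. fps_nth (1 + fps_X * Psi s) m * ystar s ^ m) \<longlonglongrightarrow> ?c"
    using coeff_limit_over_cos_poly[of 1 s] by (simp only: Psi_closed_form fps_of_poly_1 mult_1 poly_1 mult_1_right)
  then have "(\<lambda>m. fps_nth (1 + fps_X * Psi s) (Suc m) * ystar s ^ Suc m / ystar s) \<longlonglongrightarrow> ?c / ystar s"
    using y by (intro tendsto_divide tendsto_const LIMSEQ_Suc[of "\<lambda>m. fps_nth (1 + fps_X * Psi s) m * ystar s ^ m"]) auto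
  moreover have "?c / ystar s = lambda_const s"
    using c si by (simp add: ystar_def lambda_const_def tan_def field_simps power_add
        power2_eq_square power3_eq_cube)
  ultimately have "(\<lambda>m. real (N (2 * m + 2) s) * ystar s ^ m) \<longlonglongrightarrow> lambda_const s"
    using y by (simp add: Psi_def)
  moreover have "lambda_const s \<noteq> 0"
    using c si by (simp add: lambda_const_def add_nonneg_eq_0_iff)
  ultimately show ?thesis using y by (rule asymp_equiv_powi_of_limit)
qed

theorem theorem1p3:
  fixes s :: nat
  assumes "s \<ge> 1"
  shows "is_power_series_of (Phi s)
           (\<lambda>y. tan ((real s + 2) * arctan (sqrt y)) / sqrt y)
    \<and> is_power_series_of (Psi s)
           (\<lambda>y. (1 / y) * (cos (arctan (sqrt y)) ^ (s + 2)
                            / cos ((real s + 2) * arctan (sqrt y)) - 1))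
    \<and> ((\<lambda>m. real (N (2 * m + 1) s)) \<sim>[sequentially] (\<lambda>m. kappa s * ystar s powi (- int m)))
    \<and> ((\<lambda>m. real (N (2 * m + 2) s)) \<sim>[sequentially] (\<lambda>m. lambda_const s * ystar s powi (- int m)))"
  using closed_form_expansions N_odd_asymptotics N_even_asymptotics by blast

end
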